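(* Let $I\subset S=K[x_1,\dots,x_n]$ be a nonzero proper monomial ideal. Then the functions $k\mapsto \mathrm{v}_{\mathfrak p}(I^k)$, for each $\mathfrak p\in\mathrm{Ass}^\infty(I)$ and all $k\gg0$, and the function $k\mapsto\mathrm{v}(I^k)$, for $k\ge1$, do not depend on the characteristic of $K$. Explicitly: let $K,L$ be any two fields, let $M$ be a finite nonempty set of monomials $\ne 1$ in $x_1,\dots,x_n$, and let $I_K\subset K[x_1,\dots,x_n]$ and $I_L\subset L[x_1,\dots,x_n]$ be the ideals generated by $M$. Then $\mathrm{v}(I_K^k)=\mathrm{v}(I_L^k)$ for all $k\ge1$; and for every $A\subseteq\{1,\dots,n\}$, the prime $\mathfrak p_A=(x_i:i\in A)$ of $K[x_1,\dots,x_n]$ belongs to $\mathrm{Ass}^\infty(I_K)$ if and only if the prime $\mathfrak p_A$ of $L[x_1,\dots,x_n]$ belongs to $\mathrm{Ass}^\infty(I_L)$, in which case $\mathrm{v}_{\mathfrak p_A}(I_K^k)=\mathrm{v}_{\mathfrak p_A}(I_L^k)$ for all $k\gg0$.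
   Context: $S=\bigoplus_{d\ge0}S_d$ is a polynomial ring over a field with $\deg x_i=1$. For a graded ideal $I\subset S$: $\mathrm{Ass}(I)$ denotes the set of associated primes of $S/I$. For $\mathfrak p\in\mathrm{Ass}(I)$, $\mathrm{v}_{\mathfrak p}(I)=\min\{d: \exists f\in S_d \text{ with } (I:f)=\mathfrak p\}$, and $\mathrm{v}(I)=\min\{d: \exists f\in S_d\text{ with } (I:f)\in\mathrm{Ass}(I)\}$. By Brodmann, $\mathrm{Ass}(I^k)$ is constant for $k\gg0$; $\mathrm{Ass}^\infty(I)$ is the set of primes $\mathfrak p$ with $\mathfrak p\in\mathrm{Ass}(I^k)$ for all $k\gg0$. Every associated prime of a monomial ideal has the form $\mathfrak p_A=(x_i:i\in A)$ with $A\subseteq\{1,\dots,n\}$. "For all $k\gg 0$" means for all sufficiently large integers $k$. *)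

theory Defs
  imports
    "HOL-Library.Poly_Mapping"
    "HOL-Algebra.Ideal_Product"
    "HOL-Algebra.Algebraic_Closure_Type"
begin

text \<open>
  The polynomial ring in finitely many variables, indexed by the finite type \<open>'n\<close>, over the field
  \<open>'k\<close>. A monomial is represented by its exponent vector \<open>'n \<Rightarrow>\<^sub>0 nat\<close> (so the monomial \<open>1\<close> is the
  exponent vector \<open>0\<close>), and a polynomial maps each exponent vector to its coefficient; the
  multiplication on this type is the convolution product.
\<close>

type_synonym ('n, 'k) mpoly = "('n \<Rightarrow>\<^sub>0 nat) \<Rightarrow>\<^sub>0 'k"

abbreviation mpoly_ring :: "('n::finite, 'k::field) mpoly ring"
  where "mpoly_ring \<equiv> ring_of_type_algebra"

abbreviation monomial :: "('n::finite \<Rightarrow>\<^sub>0 nat) \<Rightarrow> ('n, 'k::field) mpoly"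
  where "monomial m \<equiv> Poly_Mapping.single m 1"

abbreviation var :: "'n::finite \<Rightarrow> ('n, 'k::field) mpoly"
  where "var i \<equiv> monomial (Poly_Mapping.single i 1)"

text \<open>The graded component \<open>S\<^sub>d\<close>; like every component it contains \<open>0\<close>.\<close>

definition homogeneous_component :: "nat \<Rightarrow> ('n::finite, 'k::field) mpoly set"
  where "homogeneous_component d =
    {f. \<forall>m \<in> Poly_Mapping.keys f. (\<Sum>i\<in>UNIV. Poly_Mapping.lookup m i) = d}"

definition monomial_ideal :: "('n::finite \<Rightarrow>\<^sub>0 nat) set \<Rightarrow> ('n, 'k::field) mpoly set"
  where "monomial_ideal M = Idl\<^bsub>mpoly_ring\<^esub> (monomial ` M)"

definition variable_prime :: "'n::finite set \<Rightarrow> ('n, 'k::field) mpoly set"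
  where "variable_prime A = Idl\<^bsub>mpoly_ring\<^esub> (var ` A)"

definition ideal_power :: "('a, 'b) ring_scheme \<Rightarrow> 'a set \<Rightarrow> nat \<Rightarrow> 'a set"
  where "ideal_power R I k = I [^]\<^bsub>ideals_set R\<^esub> k"

definition colon_ideal :: "('a, 'b) ring_scheme \<Rightarrow> 'a set \<Rightarrow> 'a \<Rightarrow> 'a set"
  where "colon_ideal R I f = {g \<in> carrier R. g \<otimes>\<^bsub>R\<^esub> f \<in> I}"

text \<open>
  The associated primes of the module \<open>R/I\<close>: the annihilator of the residue class of \<open>f\<close> in \<open>R/I\<close>
  is \<open>(I : f)\<close>.
\<close>

definition Ass :: "('a, 'b) ring_scheme \<Rightarrow> 'a set \<Rightarrow> 'a set set"
  where "Ass R I = {P. primeideal P R \<and> (\<exists>f \<in> carrier R. colon_ideal R I f = P)}"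

definition Ass_stable :: "('a, 'b) ring_scheme \<Rightarrow> 'a set \<Rightarrow> 'a set set"
  where "Ass_stable R I = {P. \<forall>\<^sub>F k in sequentially. P \<in> Ass R (ideal_power R I k)}"

text \<open>
  The local v-number is meaningful only for \<open>P \<in> Ass mpoly_ring I\<close>, and the v-number only for
  proper \<open>I\<close>; in both cases \<open>I\<close> has to be graded. Then the minimum is over a nonempty set.
\<close>

definition local_v_number :: "('n::finite, 'k::field) mpoly set \<Rightarrow> ('n, 'k) mpoly set \<Rightarrow> nat"
  where "local_v_number P I =
    (LEAST d. \<exists>f \<in> homogeneous_component d. colon_ideal mpoly_ring I f = P)"

definition v_number :: "('n::finite, 'k::field) mpoly set \<Rightarrow> nat"
  where "v_number I =
    (LEAST d. \<exists>f \<in> homogeneous_component d. colon_ideal mpoly_ring I f \<in> Ass mpoly_ring I)"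

end

theory Submission
  imports Defs
begin

text \<open>
  An ideal generated by monomials consists of all polynomials whose exponents lie in a fixed set
  \<open>U\<close> that is closed under adding any exponent vector, and \<open>U\<close> does not involve the field; the same
  is true of its powers and of the primes \<open>(x\<^sub>i : i \<in> A)\<close>. So it suffices to show, for a monomial
  ideal \<open>J\<close> with exponent set \<open>U\<close>, that the minima defining the v-numbers may be taken over
  monomials \<open>f = x\<^sup>u\<close> only: the equation \<open>(J : x\<^sup>u) = (x\<^sub>i : i \<in> A)\<close> is a condition on \<open>u\<close>, \<open>U\<close> and
  \<open>A\<close> alone (lemmas \<open>ex_colon_eq_variable_prime_iff\<close> and \<open>ex_colon_mem_Ass_iff\<close>).

  Let \<open>P = (J : f)\<close> be prime. If \<open>P = (x\<^sub>i : i \<in> A)\<close>, then \<open>x\<^sup>m f \<in> J\<close> for \<open>x\<^sup>m \<in> P\<close> forces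
  \<open>P \<subseteq> (J : x\<^sup>u)\<close> for every exponent \<open>u\<close> of \<open>f\<close>. If all these inclusions were strict, there
  would be a monomial outside \<open>P\<close> in each \<open>(J : x\<^sup>u)\<close>, and the product of these monomials, which
  is outside \<open>P\<close>, would lie in \<open>(J : f)\<close>. Hence \<open>P = (J : x\<^sup>u)\<close> for some exponent \<open>u\<close> of \<open>f\<close>,
  and \<open>x\<^sup>u\<close> has the degree of \<open>f\<close> when \<open>f\<close> is homogeneous.

  It remains to see that \<open>P\<close> always has this form, with \<open>A = {i. x\<^sub>i \<in> P}\<close>. Otherwise \<open>P\<close> contains
  some \<open>g \<noteq> 0\<close> in the variables outside \<open>A\<close>. By primality, some exponents \<open>u\<close> of \<open>f\<close> are not moved
  into \<open>U\<close> by any monomial in these variables. Among such \<open>u\<close> and the exponents \<open>v\<close> of \<open>g\<close>, the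
  sum \<open>u + v\<close> of the largest ones for a monomial order occurs only once. The other exponents of \<open>f\<close>
  do not contribute to \<open>x\<^sup>u\<^sup>+\<^sup>v\<close> either, since a common multiplier takes them into \<open>U\<close> and not
  \<open>u + v\<close>. So \<open>u + v\<close> is an exponent of \<open>g f \<in> J\<close> and lies in \<open>U\<close>, against the choice of \<open>u\<close>.
\<close>

section \<open>Ideals of a commutative ring given by a type\<close>

lemma ideal_ring_of_type_algebra_iff:
  fixes I :: "'a::comm_ring_1 set"
  shows "ideal I ring_of_type_algebra \<longleftrightarrow>
    0 \<in> I \<and> (\<forall>a\<in>I. \<forall>b\<in>I. a + b \<in> I) \<and> (\<forall>a\<in>I. \<forall>x. x * a \<in> I)"
proof
  assume "ideal I ring_of_type_algebra"
  then interpret ideal I "ring_of_type_algebra :: 'a ring" .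
  show "0 \<in> I \<and> (\<forall>a\<in>I. \<forall>b\<in>I. a + b \<in> I) \<and> (\<forall>a\<in>I. \<forall>x. x * a \<in> I)"
    using additive_subgroup.zero_closed [OF additive_subgroup_axioms]
      additive_subgroup.a_closed [OF additive_subgroup_axioms] I_l_closed
    by (auto simp: ring_of_type_algebra_def)
next
  assume *: "0 \<in> I \<and> (\<forall>a\<in>I. \<forall>b\<in>I. a + b \<in> I) \<and> (\<forall>a\<in>I. \<forall>x. x * a \<in> I)"
  interpret R: cring "ring_of_type_algebra :: 'a ring"
    by (rule cring_from_type_algebra)
  have neg: "- a \<in> I" if "a \<in> I" for a
    using * that by (metis mult_minus1)
  have inv: "inv\<^bsub>add_monoid ring_of_type_algebra\<^esub> a = - a" for a :: 'a
    unfolding a_inv_def [symmetric]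
    by (rule R.minus_equality) (auto simp: ring_of_type_algebra_def)
  show "ideal I ring_of_type_algebra"
  proof (rule idealI)
    show "subgroup I (add_monoid ring_of_type_algebra)"
      unfolding subgroup_def inv using * neg by (auto simp: ring_of_type_algebra_def)
  qed (use * R.ring_axioms in \<open>auto simp: ring_of_type_algebra_def mult.commute\<close>)
qed

lemma primeideal_ring_of_type_algebra_iff:
  fixes P :: "'a::comm_ring_1 set"
  shows "primeideal P ring_of_type_algebra \<longleftrightarrow>
    ideal P ring_of_type_algebra \<and> 1 \<notin> P \<and> (\<forall>a b. a * b \<in> P \<longrightarrow> a \<in> P \<or> b \<in> P)"
proof
  assume "primeideal P ring_of_type_algebra"
  then interpret primeideal P "ring_of_type_algebra :: 'a ring" .
  show "ideal P ring_of_type_algebra \<and> 1 \<notin> P \<and> (\<forall>a b. a * b \<in> P \<longrightarrow> a \<in> P \<or> b \<in> P)"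
    using ideal_axioms one_imp_carrier I_notcarr I_prime
    by (auto simp: ring_of_type_algebra_def)
next
  assume "ideal P ring_of_type_algebra \<and> 1 \<notin> P \<and> (\<forall>a b. a * b \<in> P \<longrightarrow> a \<in> P \<or> b \<in> P)"
  then show "primeideal P ring_of_type_algebra"
    by (intro primeidealI cring_from_type_algebra) (auto simp: ring_of_type_algebra_def)
qed

lemma colon_ideal_ring_of_type_algebra:
  fixes I :: "'a::comm_ring_1 set"
  shows "colon_ideal ring_of_type_algebra I f = {g. g * f \<in> I}"
  by (simp add: colon_ideal_def ring_of_type_algebra_def)

lemma ideal_sum_mem:
  fixes I :: "'a::comm_ring_1 set"
  assumes "ideal I ring_of_type_algebra" and "\<And>x. x \<in> T \<Longrightarrow> g x \<in> I"
  shows "(\<Sum>x\<in>T. g x) \<in> I"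
  using assms by (induction T rule: infinite_finite_induct)
    (auto simp: ideal_ring_of_type_algebra_iff)

section \<open>Exponents of products\<close>

lemma poly_mapping_eq_sum_single:
  fixes f :: "'a \<Rightarrow>\<^sub>0 'b::comm_monoid_add"
  shows "f = (\<Sum>u\<in>Poly_Mapping.keys f. Poly_Mapping.single u (Poly_Mapping.lookup f u))"
  by (rule poly_mapping_eqI)
    (auto simp: lookup_sum lookup_single when_def in_keys_iff)

lemma keys_times_single_one:
  fixes f :: "'a::cancel_comm_monoid_add \<Rightarrow>\<^sub>0 'b::comm_semiring_1"
  shows "Poly_Mapping.keys (Poly_Mapping.single m 1 * f) = (\<lambda>u. m + u) ` Poly_Mapping.keys f"
proof -
  have "Poly_Mapping.single m 1 * f =
      (\<Sum>u\<in>Poly_Mapping.keys f. Poly_Mapping.single (m + u) (Poly_Mapping.lookup f u))"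
    by (subst poly_mapping_eq_sum_single [of f]) (simp add: sum_distrib_left mult_single)
  then have lookup: "Poly_Mapping.lookup (Poly_Mapping.single m 1 * f) w =
      (\<Sum>u\<in>Poly_Mapping.keys f. Poly_Mapping.lookup f u when m + u = w)" for w
    by (simp add: lookup_sum lookup_single)
  have "Poly_Mapping.lookup (Poly_Mapping.single m 1 * f) (m + u) = Poly_Mapping.lookup f u" for u
    unfolding lookup by (auto simp: when_def in_keys_iff)
  moreover have "w \<in> (\<lambda>u. m + u) ` Poly_Mapping.keys f"
    if "w \<in> Poly_Mapping.keys (Poly_Mapping.single m 1 * f)" for w
    using that keys_mult [of "Poly_Mapping.single m 1" f] by (auto split: if_splits)
  ultimately show ?thesis
    by (auto simp: in_keys_iff)
qed

text \<open>A term of the product that arises in only one way does not cancel.\<close>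

lemma add_mem_keys_times:
  fixes f g :: "'a::comm_monoid_add \<Rightarrow>\<^sub>0 'b::idom"
  assumes "u \<in> Poly_Mapping.keys f" and "v \<in> Poly_Mapping.keys g"
    and unique: "\<And>u' v'. \<lbrakk>u' \<in> Poly_Mapping.keys f; v' \<in> Poly_Mapping.keys g; u' + v' = u + v\<rbrakk>
      \<Longrightarrow> u' = u \<and> v' = v"
  shows "u + v \<in> Poly_Mapping.keys (f * g)"
proof -
  let ?F = "Poly_Mapping.keys f" and ?G = "Poly_Mapping.keys g"
  let ?c = "\<lambda>p. Poly_Mapping.lookup f (fst p) * Poly_Mapping.lookup g (snd p)"
  have "f * g = (\<Sum>u\<in>?F. \<Sum>v\<in>?G. Poly_Mapping.single (u + v)
      (Poly_Mapping.lookup f u * Poly_Mapping.lookup g v))"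
    by (subst poly_mapping_eq_sum_single [of f], subst poly_mapping_eq_sum_single [of g])
      (simp add: sum_product mult_single)
  also have "\<dots> = (\<Sum>p\<in>?F \<times> ?G. Poly_Mapping.single (fst p + snd p) (?c p))"
    by (simp add: sum.cartesian_product case_prod_beta)
  finally have "Poly_Mapping.lookup (f * g) (u + v) =
      (\<Sum>p\<in>?F \<times> ?G. ?c p when fst p + snd p = u + v)"
    by (simp add: lookup_sum lookup_single)
  also have "\<dots> = (\<Sum>p\<in>{(u, v)}. ?c p when fst p + snd p = u + v)"
    by (rule sum.mono_neutral_right) (use assms in \<open>auto simp: when_def\<close>)
  finally show ?thesis
    using assms(1,2) by (simp add: in_keys_iff)
qed

text \<open>
  Any numbering of the variables embeds the exponent vectors into the finitely supported sequences,
  which carry a lexicographic order compatible with addition.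
\<close>

lemma ex_additive_injection:
  "\<exists>\<phi> :: ('n::finite \<Rightarrow>\<^sub>0 nat) \<Rightarrow> (nat \<Rightarrow>\<^sub>0 nat). inj \<phi> \<and> (\<forall>u v. \<phi> (u + v) = \<phi> u + \<phi> v)"
proof -
  obtain e :: "'n \<Rightarrow> nat" where e: "inj e"
    using finite_imp_inj_to_nat_seg [of "UNIV :: 'n set"] by auto
  define \<phi> :: "('n \<Rightarrow>\<^sub>0 nat) \<Rightarrow> (nat \<Rightarrow>\<^sub>0 nat)"
    where "\<phi> m = (\<Sum>i\<in>UNIV. Poly_Mapping.single (e i) (Poly_Mapping.lookup m i))" for m
  have "Poly_Mapping.lookup (\<phi> m) (e i) = Poly_Mapping.lookup m i" for m i
    using e by (simp add: \<phi>_def lookup_sum lookup_single when_def inj_eq)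
  then have "inj \<phi>"
    by (metis injI poly_mapping_eqI)
  moreover have "\<phi> (u + v) = \<phi> u + \<phi> v" for u v
    by (simp add: \<phi>_def lookup_add single_add sum.distrib)
  ultimately show ?thesis
    by blast
qed

lemma ex_unique_sum:
  fixes T Y :: "('n::finite \<Rightarrow>\<^sub>0 nat) set"
  assumes "finite T" "T \<noteq> {}" "finite Y" "Y \<noteq> {}"
  obtains u v where "u \<in> T" "v \<in> Y"
    and "\<And>u' v'. \<lbrakk>u' \<in> T; v' \<in> Y; u' + v' = u + v\<rbrakk> \<Longrightarrow> u' = u \<and> v' = v"
proof -
  obtain \<phi> :: "('n \<Rightarrow>\<^sub>0 nat) \<Rightarrow> (nat \<Rightarrow>\<^sub>0 nat)"
    where inj: "inj \<phi>" and add: "\<And>u v. \<phi> (u + v) = \<phi> u + \<phi> v"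
    using ex_additive_injection by blast
  have max: "\<exists>z\<in>Z. \<forall>z'\<in>Z. \<phi> z' \<le> \<phi> z" if "finite Z" "Z \<noteq> {}" for Z
    using that Max_in [of "\<phi> ` Z"] Max_ge [of "\<phi> ` Z"] by (metis (no_types, lifting)
        finite_imageI image_is_empty imageE imageI)
  obtain u where u: "u \<in> T" "\<And>u'. u' \<in> T \<Longrightarrow> \<phi> u' \<le> \<phi> u"
    using max assms by metis
  obtain v where v: "v \<in> Y" "\<And>v'. v' \<in> Y \<Longrightarrow> \<phi> v' \<le> \<phi> v"
    using max assms by metis
  show thesis
  proof (rule that)
    fix u' v' assume *: "u' \<in> T" "v' \<in> Y" "u' + v' = u + v"
    then have eq: "\<phi> u' + \<phi> v' = \<phi> u + \<phi> v"
      by (metis add)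
    have "\<phi> u' = \<phi> u"
    proof (rule ccontr)
      assume "\<phi> u' \<noteq> \<phi> u"
      then have "\<phi> u' < \<phi> u"
        using u * by (simp add: order_less_le)
      then have "\<phi> u' + \<phi> v' < \<phi> u + \<phi> v"
        using v(2) [OF *(2)] by (rule add_less_le_mono)
      with eq show False by simp
    qed
    with eq inj show "u' = u \<and> v' = v"
      by (simp add: inj_eq)
  qed (use u v in auto)
qed

section \<open>Monomial ideals and their exponent sets\<close>

text \<open>The polynomials all of whose exponents lie in \<open>U\<close>.\<close>

definition polys_on :: "('n::finite \<Rightarrow>\<^sub>0 nat) set \<Rightarrow> ('n, 'k::field) mpoly set"
  where "polys_on U = {f. Poly_Mapping.keys f \<subseteq> U}"

text \<open>
  The sets of exponent vectors closed under adding any exponent vector, that is, the exponent sets of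
  monomial ideals.
\<close>

definition upset :: "('n::finite \<Rightarrow>\<^sub>0 nat) set \<Rightarrow> bool"
  where "upset U \<longleftrightarrow> (\<forall>u\<in>U. \<forall>m. m + u \<in> U)"

text \<open>The exponents of the monomials divisible by a member of \<open>M\<close>.\<close>

definition multiples :: "('n::finite \<Rightarrow>\<^sub>0 nat) set \<Rightarrow> ('n \<Rightarrow>\<^sub>0 nat) set"
  where "multiples M = {m + a | m a. a \<in> M}"

text \<open>
  The exponent set of the \<open>k\<close>-th power of the monomial ideal with exponent set \<open>U\<close>; the power with
  exponent \<open>0\<close> is the unit ideal.
\<close>

primrec power_exponents :: "('n::finite \<Rightarrow>\<^sub>0 nat) set \<Rightarrow> nat \<Rightarrow> ('n \<Rightarrow>\<^sub>0 nat) set"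
  where
    "power_exponents U 0 = UNIV"
  | "power_exponents U (Suc k) = {u + v | u v. u \<in> power_exponents U k \<and> v \<in> U}"

lemma upset_multiples: "upset (multiples M)"
  unfolding upset_def multiples_def by simp (metis add.assoc)

lemma upset_power_exponents:
  assumes "upset U"
  shows "upset (power_exponents U k)"
proof (cases k)
  case (Suc l)
  have "\<exists>x y. m + (u + v) = x + y \<and> x \<in> power_exponents U l \<and> y \<in> U"
    if "u \<in> power_exponents U l" "v \<in> U" for m u v
  proof (intro exI conjI)
    show "m + (u + v) = u + (m + v)" by (simp add: ac_simps)
  qed (use assms that in \<open>auto simp: upset_def\<close>)
  then show ?thesis
    by (auto simp: upset_def Suc)
qed (simp add: upset_def)

lemma monomial_mem_polys_on [simp]:
  "(monomial m :: ('n::finite, 'k::field) mpoly) \<in> polys_on U \<longleftrightarrow> m \<in> U"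
  by (simp add: polys_on_def)

lemma ideal_polys_on:
  assumes "upset U"
  shows "ideal (polys_on U :: ('n::finite, 'k::field) mpoly set) mpoly_ring"
  unfolding ideal_ring_of_type_algebra_iff
proof (intro conjI ballI allI)
  fix a b :: "('n, 'k) mpoly" assume "a \<in> polys_on U" "b \<in> polys_on U"
  then show "a + b \<in> polys_on U"
    using Poly_Mapping.keys_add [of a b] by (auto simp: polys_on_def)
next
  fix a x :: "('n, 'k) mpoly" assume "a \<in> polys_on U"
  then show "x * a \<in> polys_on U"
    using keys_mult [of x a] assms unfolding polys_on_def upset_def by blast
qed (simp add: polys_on_def)

lemma polys_on_subset_ideal:
  fixes I :: "('n::finite, 'k::field) mpoly set"
  assumes "ideal I mpoly_ring" and "\<And>u c. u \<in> U \<Longrightarrow> Poly_Mapping.single u c \<in> I"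
  shows "polys_on U \<subseteq> I"
proof
  fix f :: "('n, 'k) mpoly" assume "f \<in> polys_on U"
  then show "f \<in> I"
    by (subst poly_mapping_eq_sum_single) (auto intro!: ideal_sum_mem assms simp: polys_on_def)
qed

lemma single_mem_ideal:
  fixes I :: "('n::finite, 'k::field) mpoly set"
  assumes "ideal I mpoly_ring" and "monomial a \<in> I"
  shows "Poly_Mapping.single (m + a) c \<in> I"
proof -
  have "Poly_Mapping.single m c * monomial a \<in> I"
    using assms by (simp add: ideal_ring_of_type_algebra_iff)
  then show ?thesis
    by (simp add: mult_single)
qed

lemma monomial_ideal_eq_polys_on:
  "(monomial_ideal M :: ('n::finite, 'k::field) mpoly set) = polys_on (multiples M)"
proof
  have "a \<in> multiples M" if "a \<in> M" for a
    using that unfolding multiples_def by (metis (mono_tags, lifting) add_0 mem_Collect_eq)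
  then have "monomial ` M \<subseteq> (polys_on (multiples M) :: ('n, 'k) mpoly set)"
    by auto
  then show "(monomial_ideal M :: ('n, 'k) mpoly set) \<subseteq> polys_on (multiples M)"
    unfolding monomial_ideal_def genideal_def using ideal_polys_on [OF upset_multiples] by blast
next
  show "(polys_on (multiples M) :: ('n, 'k) mpoly set) \<subseteq> monomial_ideal M"
    unfolding monomial_ideal_def genideal_def
  proof (rule Inter_greatest)
    fix I :: "('n, 'k) mpoly set"
    assume "I \<in> {I. ideal I mpoly_ring \<and> monomial ` M \<subseteq> I}"
    then show "polys_on (multiples M) \<subseteq> I"
      by (intro polys_on_subset_ideal) (auto simp: multiples_def intro: single_mem_ideal)
  qed
qed

lemma ideal_prod_polys_on:
  assumes "upset U" and "upset V"
  shows "ideal_prod mpoly_ring (polys_on U) (polys_on V) =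
    (polys_on {u + v | u v. u \<in> U \<and> v \<in> V} :: ('n::finite, 'k::field) mpoly set)"
    (is "?L = polys_on ?W")
proof
  show "?L \<subseteq> polys_on ?W"
  proof
    fix s assume "s \<in> ?L"
    then show "s \<in> polys_on ?W"
    proof induction
      case (prod f g)
      then show ?case
        using keys_mult [of f g] by (fastforce simp: ring_of_type_algebra_def polys_on_def)
    next
      case (sum f g)
      then show ?case
        using Poly_Mapping.keys_add [of f g]
        by (auto simp: ring_of_type_algebra_def polys_on_def)
    qed
  qed
next
  interpret R: cring "mpoly_ring :: ('n, 'k) mpoly ring"
    by (rule cring_from_type_algebra)
  show "polys_on ?W \<subseteq> ?L"
  proof (rule polys_on_subset_ideal)
    show "ideal ?L mpoly_ring"
      by (intro R.ideal_prod_is_ideal ideal_polys_on assms)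
  next
    fix w and c :: 'k assume "w \<in> ?W"
    then obtain u v where w: "w = u + v" "u \<in> U" "v \<in> V"
      by blast
    then have "Poly_Mapping.single u c \<otimes>\<^bsub>mpoly_ring\<^esub> monomial v \<in> ?L"
      by (intro ideal_prod.prod) (auto simp: polys_on_def)
    then show "Poly_Mapping.single w c \<in> ?L"
      by (simp add: w ring_of_type_algebra_def mult_single)
  qed
qed

lemma ideal_power_polys_on:
  assumes "upset U"
  shows "ideal_power mpoly_ring (polys_on U) k =
    (polys_on (power_exponents U k) :: ('n::finite, 'k::field) mpoly set)"
proof (induction k)
  case 0
  show ?case
    by (simp add: ideal_power_def nat_pow_def ideals_set_def ring_of_type_algebra_def polys_on_def)
next
  case (Suc k)
  have "ideal_power mpoly_ring (polys_on U) (Suc k) =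
      ideal_prod mpoly_ring (ideal_power mpoly_ring (polys_on U) k)
        (polys_on U :: ('n, 'k) mpoly set)"
    by (simp add: ideal_power_def nat_pow_def ideals_set_def)
  also have "\<dots> = polys_on (power_exponents U (Suc k))"
    unfolding Suc by (simp add: ideal_prod_polys_on upset_power_exponents assms)
  finally show ?case .
qed

section \<open>Primes generated by variables\<close>

text \<open>The exponent set of the ideal \<open>(x\<^sub>i : i \<in> A)\<close>.\<close>

definition variable_exponents :: "'n::finite set \<Rightarrow> ('n \<Rightarrow>\<^sub>0 nat) set"
  where "variable_exponents A = {m. \<exists>i\<in>A. Poly_Mapping.lookup m i \<noteq> 0}"

lemma add_mem_variable_exponents_iff [simp]:
  "u + v \<in> variable_exponents A \<longleftrightarrow> u \<in> variable_exponents A \<or> v \<in> variable_exponents A"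
  by (auto simp: variable_exponents_def lookup_add)

lemma zero_notin_variable_exponents [simp]: "0 \<notin> variable_exponents A"
  by (simp add: variable_exponents_def)

lemma upset_variable_exponents: "upset (variable_exponents A)"
  by (simp add: upset_def)

lemma diff_single_add_single:
  fixes m :: "'n \<Rightarrow>\<^sub>0 nat"
  assumes "Poly_Mapping.lookup m i \<noteq> 0"
  shows "(m - Poly_Mapping.single i 1) + Poly_Mapping.single i 1 = m"
  by (rule poly_mapping_eqI) (use assms in \<open>auto simp: lookup_add lookup_minus lookup_single when_def\<close>)

lemma variable_exponents_eq_multiples:
  "variable_exponents A = multiples ((\<lambda>i. Poly_Mapping.single i 1) ` A)"
proof (intro Set.set_eqI iffI)
  fix m assume "m \<in> variable_exponents A"
  then show "m \<in> multiples ((\<lambda>i. Poly_Mapping.single i 1) ` A)"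
    unfolding variable_exponents_def multiples_def
    by (smt (verit) diff_single_add_single image_eqI mem_Collect_eq)
next
  fix m assume "m \<in> multiples ((\<lambda>i. Poly_Mapping.single i 1) ` A)"
  then show "m \<in> variable_exponents A"
    unfolding multiples_def
    by (auto simp: variable_exponents_def lookup_single lookup_add intro: bexI [rotated])
qed

lemma variable_prime_eq_polys_on:
  "(variable_prime A :: ('n::finite, 'k::field) mpoly set) = polys_on (variable_exponents A)"
proof -
  have "(variable_prime A :: ('n, 'k) mpoly set) =
      monomial_ideal ((\<lambda>i. Poly_Mapping.single i 1) ` A)"
    by (simp add: variable_prime_def monomial_ideal_def image_image)
  then show ?thesis
    by (simp add: monomial_ideal_eq_polys_on variable_exponents_eq_multiples)
qed

lemma primeideal_variable_prime:
  "primeideal (variable_prime A :: ('n::finite, 'k::field) mpoly set) mpoly_ring"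
  unfolding primeideal_ring_of_type_algebra_iff variable_prime_eq_polys_on
proof (intro conjI allI impI)
  show "(1 :: ('n, 'k) mpoly) \<notin> polys_on (variable_exponents A)"
    by (simp add: polys_on_def)
next
  let ?V = "variable_exponents A"
  fix f g :: "('n, 'k) mpoly" assume fg: "f * g \<in> polys_on ?V"
  show "f \<in> polys_on ?V \<or> g \<in> polys_on ?V"
  proof (rule ccontr)
    assume "\<not> ?thesis"
    then have "finite (Poly_Mapping.keys f - ?V)" "Poly_Mapping.keys f - ?V \<noteq> {}"
      "finite (Poly_Mapping.keys g - ?V)" "Poly_Mapping.keys g - ?V \<noteq> {}"
      by (auto simp: polys_on_def)
    then obtain u v
      where u: "u \<in> Poly_Mapping.keys f - ?V" and v: "v \<in> Poly_Mapping.keys g - ?V"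
        and unique: "\<And>u' v'. \<lbrakk>u' \<in> Poly_Mapping.keys f - ?V; v' \<in> Poly_Mapping.keys g - ?V;
          u' + v' = u + v\<rbrakk> \<Longrightarrow> u' = u \<and> v' = v"
      by (rule ex_unique_sum) blast
    \<comment> \<open>the exponents in \<open>?V\<close> cannot contribute, as \<open>u + v\<close> lies outside it\<close>
    have "u + v \<in> Poly_Mapping.keys (f * g)"
    proof (rule add_mem_keys_times)
      fix u' v'
      assume *: "u' \<in> Poly_Mapping.keys f" "v' \<in> Poly_Mapping.keys g" "u' + v' = u + v"
      have "u' + v' \<notin> ?V"
        unfolding *(3) using u v by simp
      then have "u' \<notin> ?V" "v' \<notin> ?V"
        by simp_all
      with * show "u' = u \<and> v' = v"
        by (intro unique) auto
    qed (use u v in auto)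
    with fg u v show False
      by (auto simp: polys_on_def)
  qed
qed (rule ideal_polys_on [OF upset_variable_exponents])

text \<open>
  A prime containing a monomial contains one of the variables that divide it.
\<close>

lemma monomial_mem_primeideal:
  fixes P :: "('n::finite, 'k::field) mpoly set"
  assumes "primeideal P mpoly_ring" and "monomial m \<in> P"
  shows "m \<in> variable_exponents {i. var i \<in> P}"
  using assms(2)
proof (induction "\<Sum>i\<in>UNIV. Poly_Mapping.lookup m i" arbitrary: m rule: less_induct)
  case less
  have "m \<noteq> 0"
    using less.prems assms(1) by (auto simp: primeideal_ring_of_type_algebra_iff)
  then obtain i where i: "Poly_Mapping.lookup m i \<noteq> 0"
    by (metis lookup_zero poly_mapping_eqI)
  define m' where "m' = m - Poly_Mapping.single i 1"
  have m: "m = m' + Poly_Mapping.single i 1"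
    unfolding m'_def by (rule diff_single_add_single [OF i, symmetric])
  have "monomial m' * var i \<in> P"
    using less.prems by (simp add: m mult_single)
  then consider "monomial m' \<in> P" | "var i \<in> P"
    using assms(1) unfolding primeideal_ring_of_type_algebra_iff by blast
  then show ?case
  proof cases
    case 1
    have "(\<Sum>j\<in>UNIV. Poly_Mapping.lookup m' j) < (\<Sum>j\<in>UNIV. Poly_Mapping.lookup m j)"
      by (simp add: m lookup_add sum.distrib lookup_single when_def)
    from less.hyps [OF this 1] show ?thesis
      by (simp add: m)
  next
    case 2
    then show ?thesis
      using i by (auto simp: variable_exponents_def)
  qed
qed

section \<open>Colon ideals of monomial ideals\<close>

text \<open>
  \<open>(J : x\<^sup>u) = (x\<^sub>i : i \<in> A)\<close> for the monomial ideal \<open>J\<close> with exponent set \<open>U\<close>, expressed without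
  reference to a field.
\<close>

definition colon_is_variable_prime ::
    "('n::finite \<Rightarrow>\<^sub>0 nat) set \<Rightarrow> ('n \<Rightarrow>\<^sub>0 nat) \<Rightarrow> 'n set \<Rightarrow> bool"
  where "colon_is_variable_prime U u A \<longleftrightarrow> (\<forall>m. m + u \<in> U \<longleftrightarrow> m \<in> variable_exponents A)"

lemma colon_monomial_eq_variable_prime:
  assumes "colon_is_variable_prime U u A"
  shows "colon_ideal mpoly_ring (polys_on U) (monomial u) =
    (variable_prime A :: ('n::finite, 'k::field) mpoly set)"
proof -
  have "Poly_Mapping.keys (g * monomial u) = (\<lambda>v. u + v) ` Poly_Mapping.keys g" for g :: "('n, 'k) mpoly"
    by (simp add: mult.commute [of g] keys_times_single_one)
  then show ?thesis
    using assms unfolding colon_ideal_ring_of_type_algebra variable_prime_eq_polys_on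
    by (auto simp: polys_on_def colon_is_variable_prime_def add.commute)
qed

text \<open>
  The witness is the product of the monomials given for the single \<open>u\<close>; it involves none of the
  variables in \<open>A\<close>, as none of them does.
\<close>

lemma ex_common_multiplier:
  assumes "upset U" and "finite T"
    and "\<And>u. u \<in> T \<Longrightarrow> \<exists>m. m \<notin> variable_exponents A \<and> m + u \<in> U"
  obtains m where "m \<notin> variable_exponents A" and "\<And>u. u \<in> T \<Longrightarrow> m + u \<in> U"
proof -
  have "\<exists>m. m \<notin> variable_exponents A \<and> (\<forall>u\<in>T. m + u \<in> U)"
    using assms(2,3)
  proof (induction T rule: finite_induct)
    case empty
    show ?case
      using zero_notin_variable_exponents by blast
  next
    case (insert x T)
    then obtain m where m: "m \<notin> variable_exponents A" "\<forall>u\<in>T. m + u \<in> U"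
      by auto
    obtain m' where m': "m' \<notin> variable_exponents A" "m' + x \<in> U"
      using insert.prems by blast
    have "m + (m' + x) \<in> U" and "\<forall>u\<in>T. m' + (m + u) \<in> U"
      using assms(1) m m' by (auto simp: upset_def)
    then have "\<forall>u\<in>insert x T. m + m' + u \<in> U"
      by (simp add: ac_simps)
    then show ?case
      using m(1) m'(1) by (intro exI [of _ "m + m'"]) simp
  qed
  then show thesis
    using that by blast
qed

text \<open>Every associated prime of a monomial ideal is generated by variables.\<close>

lemma prime_colon_eq_variable_prime:
  fixes f :: "('n::finite, 'k::field) mpoly"
  assumes U: "upset U" and prime: "primeideal (colon_ideal mpoly_ring (polys_on U) f) mpoly_ring"
  obtains A where "colon_ideal mpoly_ring (polys_on U) f = variable_prime A"
proof -
  define P where "P = colon_ideal mpoly_ring (polys_on U) f"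
  note prime = prime [folded P_def]
  then have P: "ideal P mpoly_ring"
    by (simp add: primeideal_ring_of_type_algebra_iff)
  have mem_P: "g \<in> P \<longleftrightarrow> g * f \<in> polys_on U" for g
    by (simp add: P_def colon_ideal_ring_of_type_algebra)
  define A where "A = {i. var i \<in> P}"
  let ?V = "variable_exponents A"
  have A_sub: "polys_on ?V \<subseteq> P"
    unfolding variable_exponents_eq_multiples
    by (rule polys_on_subset_ideal [OF P])
      (auto simp: multiples_def A_def intro: single_mem_ideal [OF P, unfolded One_nat_def])
  have "g \<in> polys_on ?V" if "g \<in> P" for g
  proof (rule ccontr)
    assume g: "g \<notin> polys_on ?V"
    \<comment> \<open>the part of \<open>g\<close> in the variables outside \<open>A\<close>\<close>
    define h where "h = Poly_Mapping.mapp (\<lambda>m c. c when m \<notin> ?V) g"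
    have lookup_h: "Poly_Mapping.lookup h m = (Poly_Mapping.lookup g m when m \<notin> ?V)" for m
      by (simp add: h_def lookup_mapp when_def in_keys_iff)
    have h_off: "v \<notin> ?V" if "v \<in> Poly_Mapping.keys h" for v
      using that by (simp add: in_keys_iff lookup_h)
    obtain m where "m \<in> Poly_Mapping.keys g" "m \<notin> ?V"
      using g by (auto simp: polys_on_def)
    then have "m \<in> Poly_Mapping.keys h"
      by (simp add: in_keys_iff lookup_h)
    then have h_nz: "Poly_Mapping.keys h \<noteq> {}"
      by blast
    have "h - g \<in> polys_on ?V"
      by (auto simp: polys_on_def in_keys_iff lookup_h lookup_minus when_def split: if_splits)
    then have "(h - g) + g \<in> P"
      using A_sub \<open>g \<in> P\<close> P unfolding ideal_ring_of_type_algebra_iff by blast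
    then have hf: "f * h \<in> polys_on U"
      by (simp add: mem_P mult.commute)
    \<comment> \<open>the exponents of \<open>f\<close> that no monomial in the variables outside \<open>A\<close> moves into \<open>U\<close>\<close>
    define T where "T = {u \<in> Poly_Mapping.keys f. \<forall>m. m \<notin> ?V \<longrightarrow> m + u \<notin> U}"
    have "finite (Poly_Mapping.keys f - T)"
      by simp
    then obtain n where n: "n \<notin> ?V" "\<And>u. u \<in> Poly_Mapping.keys f - T \<Longrightarrow> n + u \<in> U"
      by (rule ex_common_multiplier [OF U]) (auto simp: T_def)
    have fin: "finite T"
      by (simp add: T_def)
    have "T \<noteq> {}"
    proof
      assume "T = {}"
      then have "monomial n \<in> P"
        using n(2) by (auto simp: mem_P polys_on_def keys_times_single_one)
      then show False
        using monomial_mem_primeideal [OF prime] n(1) by (simp add: A_def)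
    qed
    moreover have "finite T"
      by (simp add: T_def)
    ultimately obtain u v where u: "u \<in> T" and v: "v \<in> Poly_Mapping.keys h"
      and unique: "\<And>u' v'. \<lbrakk>u' \<in> T; v' \<in> Poly_Mapping.keys h; u' + v' = u + v\<rbrakk>
        \<Longrightarrow> u' = u \<and> v' = v"
      using ex_unique_sum [OF fin _ finite_keys h_nz] by blast
    have "n + v \<notin> ?V"
      using n(1) h_off [OF v] by simp
    then have off: "n + v + u \<notin> U"
      using u by (simp add: T_def)
    have "u + v \<in> Poly_Mapping.keys (f * h)"
    proof (rule add_mem_keys_times)
      fix u' v'
      assume *: "u' \<in> Poly_Mapping.keys f" "v' \<in> Poly_Mapping.keys h" "u' + v' = u + v"
      \<comment> \<open>otherwise \<open>n\<close> would move \<open>u'\<close>, hence also \<open>u' + v' = u + v\<close>, into \<open>U\<close>\<close>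
      have "u' \<in> T"
      proof (rule ccontr)
        assume "u' \<notin> T"
        then have "v' + (n + u') \<in> U"
          using n(2) * U by (simp add: upset_def)
        also have "v' + (n + u') = n + (u' + v')"
          by (simp add: ac_simps)
        also have "\<dots> = n + v + u"
          by (simp add: * ac_simps)
        finally show False
          using off by simp
      qed
      then show "u' = u \<and> v' = v"
        using * by (intro unique)
    qed (use u v in \<open>auto simp: T_def\<close>)
    with hf have "u + v \<in> U"
      by (auto simp: polys_on_def)
    then have "n + (u + v) \<in> U"
      using U by (simp add: upset_def)
    with off show False
      by (simp add: ac_simps)
  qed
  then have "P = variable_prime A"
    using A_sub by (auto simp: variable_prime_eq_polys_on)
  then show thesis
    using that by (simp add: P_def)
qed

lemma colon_eq_variable_prime_imp_ex_key:
  fixes f :: "('n::finite, 'k::field) mpoly"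
  assumes U: "upset U" and eq: "colon_ideal mpoly_ring (polys_on U) f = variable_prime A"
  obtains u where "u \<in> Poly_Mapping.keys f" and "colon_is_variable_prime U u A"
proof -
  have *: "m \<in> variable_exponents A \<longleftrightarrow> (\<forall>u\<in>Poly_Mapping.keys f. m + u \<in> U)" for m
  proof -
    have "m \<in> variable_exponents A \<longleftrightarrow> monomial m * f \<in> polys_on U"
      using eq by (auto simp: colon_ideal_ring_of_type_algebra variable_prime_eq_polys_on
          set_eq_iff dest: spec [of _ "monomial m"])
    then show ?thesis
      by (auto simp: polys_on_def keys_times_single_one)
  qed
  have "\<exists>u\<in>Poly_Mapping.keys f. \<forall>m. m \<notin> variable_exponents A \<longrightarrow> m + u \<notin> U"
  proof (rule ccontr)
    assume "\<not> ?thesis"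
    then obtain m where "m \<notin> variable_exponents A" "\<And>u. u \<in> Poly_Mapping.keys f \<Longrightarrow> m + u \<in> U"
      by (metis ex_common_multiplier [OF U finite_keys])
    with * show False
      by blast
  qed
  then show thesis
    using that * unfolding colon_is_variable_prime_def by blast
qed

section \<open>Reduction of the v-numbers to exponents\<close>

abbreviation total_degree :: "('n::finite \<Rightarrow>\<^sub>0 nat) \<Rightarrow> nat"
  where "total_degree u \<equiv> \<Sum>i\<in>UNIV. Poly_Mapping.lookup u i"

lemma ex_colon_eq_variable_prime_iff:
  assumes "upset U"
  shows "(\<exists>f \<in> homogeneous_component d. colon_ideal mpoly_ring (polys_on U) f =
      (variable_prime A :: ('n::finite, 'k::field) mpoly set)) \<longleftrightarrow>
    (\<exists>u. total_degree u = d \<and> colon_is_variable_prime U u A)"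
proof
  assume "\<exists>f \<in> homogeneous_component d. colon_ideal mpoly_ring (polys_on U) f =
      (variable_prime A :: ('n, 'k) mpoly set)"
  then show "\<exists>u. total_degree u = d \<and> colon_is_variable_prime U u A"
    by (metis (mono_tags, lifting) assms colon_eq_variable_prime_imp_ex_key
        homogeneous_component_def mem_Collect_eq)
next
  assume "\<exists>u. total_degree u = d \<and> colon_is_variable_prime U u A"
  then obtain u where u: "total_degree u = d" "colon_is_variable_prime U u A"
    by blast
  then have "(monomial u :: ('n, 'k) mpoly) \<in> homogeneous_component d"
    by (simp add: homogeneous_component_def)
  with colon_monomial_eq_variable_prime [OF u(2)]
  show "\<exists>f \<in> homogeneous_component d. colon_ideal mpoly_ring (polys_on U) f =
      (variable_prime A :: ('n, 'k) mpoly set)"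
    by blast
qed

lemma Ass_polys_on_eq:
  assumes "upset U"
  shows "Ass mpoly_ring (polys_on U :: ('n::finite, 'k::field) mpoly set) =
    {variable_prime A | A. \<exists>u. colon_is_variable_prime U u A}"
proof (intro Set.set_eqI iffI)
  fix P :: "('n, 'k) mpoly set" assume "P \<in> Ass mpoly_ring (polys_on U)"
  then obtain f where P: "primeideal P mpoly_ring" "colon_ideal mpoly_ring (polys_on U) f = P"
    by (auto simp: Ass_def)
  then obtain A where A: "P = variable_prime A"
    using prime_colon_eq_variable_prime [OF assms] by metis
  then show "P \<in> {variable_prime A | A. \<exists>u. colon_is_variable_prime U u A}"
    using P(2) colon_eq_variable_prime_imp_ex_key [OF assms] by blast
next
  fix P :: "('n, 'k) mpoly set"
  assume "P \<in> {variable_prime A | A. \<exists>u. colon_is_variable_prime U u A}"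
  then obtain A u where P: "P = variable_prime A" and u: "colon_is_variable_prime U u A"
    by blast
  have "monomial u \<in> carrier (mpoly_ring :: ('n, 'k) mpoly ring)"
    by (simp add: ring_of_type_algebra_def)
  then show "P \<in> Ass mpoly_ring (polys_on U)"
    using colon_monomial_eq_variable_prime [OF u] primeideal_variable_prime
    unfolding Ass_def P by blast
qed

lemma variable_prime_inject:
  assumes "(variable_prime A :: ('n::finite, 'k::field) mpoly set) = variable_prime B"
  shows "A = B"
proof -
  have "i \<in> C \<longleftrightarrow> (var i :: ('n, 'k) mpoly) \<in> variable_prime C" for i and C :: "'n set"
    by (simp add: variable_prime_eq_polys_on variable_exponents_def lookup_single when_def)
  then show ?thesis
    using assms by blast
qed

lemma ex_colon_mem_Ass_iff:
  assumes "upset U"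
  shows "(\<exists>f \<in> homogeneous_component d. colon_ideal mpoly_ring (polys_on U) f \<in>
      Ass mpoly_ring (polys_on U :: ('n::finite, 'k::field) mpoly set)) \<longleftrightarrow>
    (\<exists>A u. total_degree u = d \<and> colon_is_variable_prime U u A)"
proof -
  have "(\<exists>f \<in> homogeneous_component d. colon_ideal mpoly_ring (polys_on U) f \<in>
      Ass mpoly_ring (polys_on U :: ('n, 'k) mpoly set)) \<longleftrightarrow>
    (\<exists>A. (\<exists>u. colon_is_variable_prime U u A) \<and>
      (\<exists>f \<in> homogeneous_component d. colon_ideal mpoly_ring (polys_on U) f =
        (variable_prime A :: ('n, 'k) mpoly set)))"
    unfolding Ass_polys_on_eq [OF assms] by blast
  then show ?thesis
    unfolding ex_colon_eq_variable_prime_iff [OF assms] by blast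
qed

lemma variable_prime_mem_Ass_iff:
  assumes "upset U"
  shows "(variable_prime A :: ('n::finite, 'k::field) mpoly set) \<in> Ass mpoly_ring (polys_on U) \<longleftrightarrow>
    (\<exists>u. colon_is_variable_prime U u A)"
  unfolding Ass_polys_on_eq [OF assms] by (auto dest: variable_prime_inject)

theorem proposition2p5:
  fixes M :: "('n::finite \<Rightarrow>\<^sub>0 nat) set"
    and I_K :: "('n, 'k::field) mpoly set"
    and I_L :: "('n, 'l::field) mpoly set"
  assumes "finite M" and "M \<noteq> {}" and "0 \<notin> M"
    and I_K: "I_K = monomial_ideal M"
    and I_L: "I_L = monomial_ideal M"
  shows "(\<forall>k\<ge>1. v_number (ideal_power mpoly_ring I_K k) = v_number (ideal_power mpoly_ring I_L k)) \<and>
    (\<forall>A :: 'n set.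
      ((variable_prime A :: ('n, 'k) mpoly set) \<in> Ass_stable mpoly_ring I_K \<longleftrightarrow>
       (variable_prime A :: ('n, 'l) mpoly set) \<in> Ass_stable mpoly_ring I_L) \<and>
      ((variable_prime A :: ('n, 'k) mpoly set) \<in> Ass_stable mpoly_ring I_K \<longrightarrow>
       (\<forall>\<^sub>F k in sequentially.
          local_v_number (variable_prime A) (ideal_power mpoly_ring I_K k) =
          local_v_number (variable_prime A) (ideal_power mpoly_ring I_L k))))"
proof -
  let ?E = "power_exponents (multiples M)"
  have power_K: "ideal_power mpoly_ring I_K k = polys_on (?E k)"
    and power_L: "ideal_power mpoly_ring I_L k = polys_on (?E k)" for k
    by (simp_all add: I_K I_L monomial_ideal_eq_polys_on ideal_power_polys_on upset_multiples)
  have up: "upset (?E k)" for k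
    by (simp add: upset_power_exponents upset_multiples)
  show ?thesis
    unfolding v_number_def local_v_number_def Ass_stable_def power_K power_L mem_Collect_eq
      ex_colon_mem_Ass_iff [OF up] ex_colon_eq_variable_prime_iff [OF up]
      variable_prime_mem_Ass_iff [OF up]
    by simp
qed

end
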